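(* Every locally convex real topological vector space is a quasi-locally convex topological vector space.
   Context: All vector spaces are real; $\mathbb{R}^+=[0,\infty)$; $\theta$ denotes the origin of $X$. Locally convex topological vector space: a topological vector space $(X,\tau)$ for which there is a family of seminorms $\{p_\lambda\}_{\lambda\in\Lambda}$ on $X$ such that $\tau$ is the initial topology induced by these seminorms, i.e. the coarsest topology on $X$ for which all mappings $x\mapsto p_\lambda(x-y)$, $y\in X$, $\lambda\in\Lambda$, are continuous. Weaknorm: a mapping $p: X\to\mathbb{R}^+$ on a vector space $X$ such that (W1) $p(x)\ge 0$ for all $x\in X$ and $p(\theta)=0$; (W2) $p(-x)=p(x)$ for all $x\in X$; (W3) $p(\alpha x_1+(1-\alpha)x_2)\le \alpha p(x_1)+(1-\alpha)p(x_2)$ for all $x_1,x_2\in X$ and $0\le\alpha\le 1$. Quasi-weaknorm: a mapping $q: X\to\mathbb{R}^+$ for which there exist a weaknorm $p$ on $X$ (called the adjoint weaknorm of $q$) and a strictly increasing continuous function $\varphi:\mathbb{R}^+\to\mathbb{R}^+$ (called the associated weighted function of $q$) such that (W4) $q(x)\le\varphi(p(x))$ for all $x\in X$; (W5) $\varphi(0)=0$. Quasi-locally convex topological vector space: a topological vector space $(X,\tau)$ for which there is a family $\{q_\lambda\}_{\lambda\in\Lambda}$ of $\tau$-continuous quasi-weaknorms on $X$, with $\tau$-continuous adjoint weaknorms $\{p_\lambda\}_{\lambda\in\Lambda}$ and associated weighted functions $\{\varphi_\lambda\}_{\lambda\in\Lambda}$, such that $\tau$ is the initial topology induced by $\{q_\lambda\}_{\lambda\in\Lambda}$,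 i.e. $\tau$ is the coarsest topology on $X$ for which all mappings $x\mapsto q_\lambda(x-y)$, $y\in X$, $\lambda\in\Lambda$, are continuous. *)

theory Defs
  imports "HOL-Analysis.Analysis"
begin

text \<open>
  The carrier of a vector space is a whole type of class \<^class>\<open>real_vector\<close>; its topology is an
  explicit \<open>'a topology\<close> with full carrier. No separation axiom is part of the notion of a
  topological vector space.
\<close>

definition real_tvs :: "'a::real_vector topology \<Rightarrow> bool" where
  "real_tvs T \<longleftrightarrow>
     topspace T = UNIV \<and>
     continuous_map (prod_topology T T) T (\<lambda>(x, y). x + y) \<and>
     continuous_map (prod_topology euclideanreal T) T (\<lambda>(a, x). a *\<^sub>R x)"

text \<open>
  A family of functions enters only through its set of members. The topology below is the coarsest
  one making the maps \<open>x \<mapsto> q (x - y)\<close>, and not just \<open>q\<close> itself, continuous.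
  Values of the functions are nonnegative where this is used, and continuity into \<open>[0, \<infinity>)\<close> is
  the same as continuity into the real line.
\<close>

definition translates_continuous :: "('a::real_vector \<Rightarrow> real) set \<Rightarrow> 'a topology \<Rightarrow> bool" where
  "translates_continuous Q T \<longleftrightarrow>
     (\<forall>q\<in>Q. \<forall>y. continuous_map T euclideanreal (\<lambda>x. q (x - y)))"

definition is_initial_topology :: "('a::real_vector \<Rightarrow> real) set \<Rightarrow> 'a topology \<Rightarrow> bool" where
  "is_initial_topology Q T \<longleftrightarrow>
     topspace T = UNIV \<and>
     translates_continuous Q T \<and>
     (\<forall>S. topspace S = UNIV \<and> translates_continuous Q S \<longrightarrow>
        (\<forall>U. openin T U \<longrightarrow> openin S U))"

definition seminorm :: "('a::real_vector \<Rightarrow> real) \<Rightarrow> bool" where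
  "seminorm p \<longleftrightarrow>
     (\<forall>x. 0 \<le> p x) \<and>
     (\<forall>a x. p (a *\<^sub>R x) = \<bar>a\<bar> * p x) \<and>
     (\<forall>x y. p (x + y) \<le> p x + p y)"

definition locally_convex_tvs :: "'a::real_vector topology \<Rightarrow> bool" where
  "locally_convex_tvs T \<longleftrightarrow>
     real_tvs T \<and> (\<exists>P. (\<forall>p\<in>P. seminorm p) \<and> is_initial_topology P T)"

definition weaknorm :: "('a::real_vector \<Rightarrow> real) \<Rightarrow> bool" where
  "weaknorm p \<longleftrightarrow>
     (\<forall>x. 0 \<le> p x) \<and> p 0 = 0 \<and>
     (\<forall>x. p (- x) = p x) \<and>
     (\<forall>x1 x2 a. 0 \<le> a \<and> a \<le> 1 \<longrightarrow>
        p (a *\<^sub>R x1 + (1 - a) *\<^sub>R x2) \<le> a * p x1 + (1 - a) * p x2)"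

text \<open>
  A function \<open>[0, \<infinity>) \<rightarrow> [0, \<infinity>)\<close> is a real function of which only the restriction to \<open>{0..}\<close>
  matters.
\<close>

definition weighted_function :: "(real \<Rightarrow> real) \<Rightarrow> bool" where
  "weighted_function \<phi> \<longleftrightarrow>
     \<phi> \<in> {0..} \<rightarrow> {0..} \<and> strict_mono_on {0..} \<phi> \<and> continuous_on {0..} \<phi> \<and> \<phi> 0 = 0"

text \<open>\<open>q\<close> is a quasi-weaknorm with adjoint weaknorm \<open>p\<close> and associated weighted function \<open>\<phi>\<close>.\<close>

definition quasi_weaknorm_with ::
    "('a::real_vector \<Rightarrow> real) \<Rightarrow> ('a \<Rightarrow> real) \<Rightarrow> (real \<Rightarrow> real) \<Rightarrow> bool" where
  "quasi_weaknorm_with q p \<phi> \<longleftrightarrow>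
     (\<forall>x. 0 \<le> q x) \<and> weaknorm p \<and> weighted_function \<phi> \<and> (\<forall>x. q x \<le> \<phi> (p x))"

text \<open>
  The three families \<open>q\<^sub>\<lambda>\<close>, \<open>p\<^sub>\<lambda>\<close>, \<open>\<phi>\<^sub>\<lambda>\<close> with a common index set are a set of
  triples; only the first components generate the topology.
\<close>

definition quasi_locally_convex_tvs :: "'a::real_vector topology \<Rightarrow> bool" where
  "quasi_locally_convex_tvs T \<longleftrightarrow>
     real_tvs T \<and>
     (\<exists>F. (\<forall>(q, p, \<phi>)\<in>F. quasi_weaknorm_with q p \<phi> \<and>
             continuous_map T euclideanreal q \<and> continuous_map T euclideanreal p) \<and>
          is_initial_topology (fst ` F) T)"

end

theory Submission
  imports Defs
begin

text \<open>
  A seminorm is already a quasi-weaknorm, being its own adjoint weaknorm with the identity as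
  weighted function: absolute homogeneity gives the value zero at the origin and symmetry, and
  together with subadditivity it gives convexity. Hence the very family of seminorms that
  generates a locally convex topology, with each member taken both as quasi-weaknorm and as its
  own adjoint, witnesses quasi-local convexity. The continuity required of these functions
  is that of the translate by the origin in the definition of the initial topology.
\<close>

lemma seminorm_imp_weaknorm:
  assumes "seminorm p"
  shows "weaknorm p"
proof -
  have hom: "p (a *\<^sub>R x) = \<bar>a\<bar> * p x" and tri: "p (x + y) \<le> p x + p y"
    and nonneg: "0 \<le> p x" for a x y
    using assms unfolding seminorm_def by auto
  have "p 0 = 0" using hom[of 0 0] by simp
  moreover have "p (- x) = p x" for x using hom[of "-1" x] by simp
  moreover have "p (a *\<^sub>R x + (1 - a) *\<^sub>R y) \<le> a * p x + (1 - a) * p y"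
    if "0 \<le> a" "a \<le> 1" for a x y
    using tri[of "a *\<^sub>R x" "(1 - a) *\<^sub>R y"] hom[of a x] hom[of "1 - a" y] that by simp
  ultimately show ?thesis
    using nonneg unfolding weaknorm_def by blast
qed

lemma weaknorm_imp_quasi_weaknorm_with_self:
  assumes "weaknorm p"
  shows "quasi_weaknorm_with p p (\<lambda>t. t)"
  using assms
  unfolding quasi_weaknorm_with_def weighted_function_def weaknorm_def strict_mono_on_def
  by simp

lemma is_initial_topology_imp_continuous_map:
  assumes "is_initial_topology Q T" "q \<in> Q"
  shows "continuous_map T euclideanreal q"
proof -
  have "continuous_map T euclideanreal (\<lambda>x. q (x - 0))"
    using assms unfolding is_initial_topology_def translates_continuous_def by blast
  then show ?thesis by simp
qed

theorem lemma3p7: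
  fixes T :: "'a::real_vector topology"
  assumes "locally_convex_tvs T"
  shows "quasi_locally_convex_tvs T"
proof -
  obtain P where T: "real_tvs T" and P: "\<forall>p\<in>P. seminorm p" "is_initial_topology P T"
    using assms unfolding locally_convex_tvs_def by blast
  define F where "F = (\<lambda>p::'a \<Rightarrow> real. (p, p, \<lambda>t::real. t)) ` P"
  have "quasi_weaknorm_with p p (\<lambda>t. t)" "continuous_map T euclideanreal p"
    if "p \<in> P" for p
    using that P weaknorm_imp_quasi_weaknorm_with_self[OF seminorm_imp_weaknorm]
      is_initial_topology_imp_continuous_map by blast+
  then have "\<forall>(q, p, \<phi>)\<in>F. quasi_weaknorm_with q p \<phi> \<and>
      continuous_map T euclideanreal q \<and> continuous_map T euclideanreal p"
    unfolding F_def by simp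
  moreover have "fst ` F = P"
    unfolding F_def by (simp add: image_image)
  ultimately show ?thesis
    unfolding quasi_locally_convex_tvs_def using T P(2) by (intro conjI exI[of _ F]) simp_all
qed

end
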